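(* Let $M$ be a geodesically-complete CAT(0) space equipped with an isometric transitive action of a group $G$. Assume that for each $\xi\in\partial M$ the isotropy subgroup $P_\xi:=\{g\in G\mid g\cdot\xi=\xi\}$ of $G$ at $\xi$ acts on $M$ transitively. Then the metric $G$-space $M$ has Property (S).
   Context: CAT(0) spaces are geodesic metric spaces satisfying the usual comparison inequality with Euclidean triangles. A geodesic segment is an isometric map $[a,b]\to M$ with $-\infty<a<b<\infty$; $M$ is geodesically-complete if every geodesic segment can be extended to a geodesic line $\mathbb{R}\to M$ (an isometric map). A geodesic ray is an isometric map $c:[0,\infty)\to M$. Two geodesic rays $c,c'$ are asymptotic if there is $a\ge0$ with $d(c(t),c'(t))\le a$ for all $t\in[0,\infty)$. The boundary $\partial M$ is the set of asymptoty classes of geodesic rays in $M$; an isometric action of $G$ on $M$ induces an action of $G$ on the set $\partial M$. Property (S) for the metric $G$-space $M$ (with metric $d$): for each $r\ge 0$ there exists $\tau(r)\ge 0$ such that for any $p_0,p,q\in M$ with $d(p,p_0)\le r$ one can choose $g\in G$ with $g\cdot p=p_0$ and $d(q,g\cdot q)\le\tau(r)$. *)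

theory Defs
  imports "HOL-Analysis.Analysis" "HOL-Algebra.Group_Action"
begin

section \<open>Geodesics\<close>

definition isometric_map_on :: "real set \<Rightarrow> (real \<Rightarrow> 'a::metric_space) \<Rightarrow> bool" where
  "isometric_map_on I c \<longleftrightarrow> (\<forall>s\<in>I. \<forall>t\<in>I. dist (c s) (c t) = dist s t)"

text \<open>Geodesics on an interval are total functions on the reals; their values outside the
  interval are irrelevant.\<close>

definition geodesic_segment :: "real \<Rightarrow> real \<Rightarrow> (real \<Rightarrow> 'a::metric_space) \<Rightarrow> bool" where
  "geodesic_segment a b c \<longleftrightarrow> a < b \<and> isometric_map_on {a..b} c"

definition geodesic_ray :: "(real \<Rightarrow> 'a::metric_space) \<Rightarrow> bool" where
  "geodesic_ray c \<longleftrightarrow> isometric_map_on {0..} c"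

definition geodesic_line :: "(real \<Rightarrow> 'a::metric_space) \<Rightarrow> bool" where
  "geodesic_line c \<longleftrightarrow> isometric_map_on UNIV c"

definition geodesically_complete :: "'a::metric_space itself \<Rightarrow> bool" where
  "geodesically_complete _ \<longleftrightarrow>
     (\<forall>a b. \<forall>c :: real \<Rightarrow> 'a. geodesic_segment a b c \<longrightarrow>
        (\<exists>l. geodesic_line l \<and> (\<forall>t\<in>{a..b}. l t = c t)))"

section \<open>CAT(0) spaces\<close>

text \<open>\<open>S\<close> is the image of a geodesic from \<open>x\<close> to \<open>y\<close>. For \<open>x = y\<close> this is the single point
  \<open>{x}\<close>, so that degenerate triangles are allowed below.\<close>

definition geodesic_side :: "'a::metric_space set \<Rightarrow> 'a \<Rightarrow> 'a \<Rightarrow> bool" where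
  "geodesic_side S x y \<longleftrightarrow>
     (\<exists>c. isometric_map_on {0..dist x y} c \<and> c 0 = x \<and> c (dist x y) = y \<and>
          S = c ` {0..dist x y})"

definition geodesic_space :: "'a::metric_space itself \<Rightarrow> bool" where
  "geodesic_space _ \<longleftrightarrow> (\<forall>x y :: 'a. \<exists>S. geodesic_side S x y)"

text \<open>\<open>x'\<close> is the comparison point, on the Euclidean segment from \<open>p'\<close> to \<open>q'\<close>, of the point
  \<open>x\<close> on the side \<open>S\<close> from \<open>p\<close> to \<open>q\<close>.\<close>

definition comparison_point ::
  "'a::metric_space set \<Rightarrow> 'a \<Rightarrow> real^2 \<Rightarrow> real^2 \<Rightarrow> 'a \<Rightarrow> real^2 \<Rightarrow> bool" where
  "comparison_point S p p' q' x x' \<longleftrightarrow>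
     x \<in> S \<and> x' \<in> closed_segment p' q' \<and> dist p' x' = dist p x"

definition CAT0 :: "'a::metric_space itself \<Rightarrow> bool" where
  "CAT0 _ \<longleftrightarrow> geodesic_space TYPE('a) \<and>
     (\<forall>(p::'a) q r S\<^sub>1 S\<^sub>2 S\<^sub>3 p' q' r'.
        geodesic_side S\<^sub>1 p q \<and> geodesic_side S\<^sub>2 q r \<and> geodesic_side S\<^sub>3 r p \<and>
        dist p' q' = dist p q \<and> dist q' r' = dist q r \<and> dist r' p' = dist r p \<longrightarrow>
        (let comp = (\<lambda>x x'. comparison_point S\<^sub>1 p p' q' x x' \<or>
                            comparison_point S\<^sub>2 q q' r' x x' \<or>
                            comparison_point S\<^sub>3 r r' p' x x')
         in \<forall>x y x' y'. comp x x' \<and> comp y y' \<longrightarrow> dist x y \<le> dist x' y'))"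

section \<open>The boundary\<close>

definition asymptotic :: "(real \<Rightarrow> 'a::metric_space) \<Rightarrow> (real \<Rightarrow> 'a) \<Rightarrow> bool" where
  "asymptotic c c' \<longleftrightarrow> (\<exists>a\<ge>0. \<forall>t\<ge>0. dist (c t) (c' t) \<le> a)"

definition asymptotic_rel :: "((real \<Rightarrow> 'a::metric_space) \<times> (real \<Rightarrow> 'a)) set" where
  "asymptotic_rel = {(c, c'). geodesic_ray c \<and> geodesic_ray c' \<and> asymptotic c c'}"

definition boundary :: "(real \<Rightarrow> 'a::metric_space) set set" where
  "boundary = {c. geodesic_ray c} // asymptotic_rel"

lemma equiv_asymptotic_rel:
  "equiv {c :: real \<Rightarrow> 'a::metric_space. geodesic_ray c} asymptotic_rel"
proof (rule equivI)
  show "asymptotic_rel \<subseteq> {c :: real \<Rightarrow> 'a. geodesic_ray c} \<times> {c. geodesic_ray c}"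
    by (auto simp: asymptotic_rel_def)
  show "refl_on {c :: real \<Rightarrow> 'a. geodesic_ray c} asymptotic_rel"
    by (auto simp: refl_on_def asymptotic_rel_def asymptotic_def)
  show "sym (asymptotic_rel :: ((real \<Rightarrow> 'a) \<times> _) set)"
    by (auto simp: sym_def asymptotic_rel_def asymptotic_def dist_commute)
  show "trans (asymptotic_rel :: ((real \<Rightarrow> 'a) \<times> _) set)"
  proof (rule transI)
    fix c d e :: "real \<Rightarrow> 'a"
    assume "(c, d) \<in> asymptotic_rel" "(d, e) \<in> asymptotic_rel"
    then obtain a b where ab: "a \<ge> 0" "b \<ge> 0" "geodesic_ray c" "geodesic_ray e"
      "\<And>t. t \<ge> 0 \<Longrightarrow> dist (c t) (d t) \<le> a" "\<And>t. t \<ge> 0 \<Longrightarrow> dist (d t) (e t) \<le> b"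
      by (auto simp: asymptotic_rel_def asymptotic_def)
    have "dist (c t) (e t) \<le> a + b" if "t \<ge> 0" for t
      using dist_triangle[of "c t" "e t" "d t"] ab(5,6)[OF that] by linarith
    with ab show "(c, e) \<in> asymptotic_rel"
      by (auto simp: asymptotic_rel_def asymptotic_def intro!: exI[of _ "a + b"])
  qed
qed

section \<open>Isometric actions\<close>

definition isometric_action ::
  "('g, 'm) monoid_scheme \<Rightarrow> ('g \<Rightarrow> 'a::metric_space \<Rightarrow> 'a) \<Rightarrow> bool" where
  "isometric_action G \<phi> \<longleftrightarrow> group_action G UNIV \<phi> \<and>
     (\<forall>g\<in>carrier G. \<forall>x y. dist (\<phi> g x) (\<phi> g y) = dist x y)"

text \<open>The induced action sends the class of \<open>c\<close> to the class of \<open>\<phi> g \<circ> c\<close>. As \<open>\<phi> g\<close> is a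
  bijective isometry, that class is the image of the class of \<open>c\<close>; see
  \<open>boundary_action_class\<close> below.\<close>

definition boundary_action ::
  "('g \<Rightarrow> 'a::metric_space \<Rightarrow> 'a) \<Rightarrow> 'g \<Rightarrow> (real \<Rightarrow> 'a) set \<Rightarrow> (real \<Rightarrow> 'a) set" where
  "boundary_action \<phi> g \<xi> = (\<lambda>c. \<phi> g \<circ> c) ` \<xi>"

lemma boundary_action_class:
  fixes \<phi> :: "'g \<Rightarrow> 'a::metric_space \<Rightarrow> 'a"
  assumes act: "isometric_action G \<phi>" and g: "g \<in> carrier G" and c: "geodesic_ray c"
  shows "geodesic_ray (\<phi> g \<circ> c)"
    and "boundary_action \<phi> g (asymptotic_rel `` {c}) = asymptotic_rel `` {\<phi> g \<circ> c}"
proof -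
  interpret group_action G UNIV \<phi>
    using act by (simp add: isometric_action_def)
  have iso: "dist (\<phi> g x) (\<phi> g y) = dist x y" for x y
    using act g by (auto simp: isometric_action_def)
  have "surj (\<phi> g)"
    using surj_prop[OF g] by simp
  then have lift: "\<exists>d. e = \<phi> g \<circ> d" for e :: "real \<Rightarrow> 'a"
    by (intro exI[of _ "inv_into UNIV (\<phi> g) \<circ> e"]) (simp add: fun_eq_iff surj_f_inv_f)
  have ray: "geodesic_ray (\<phi> g \<circ> d) \<longleftrightarrow> geodesic_ray d" for d
    by (simp add: geodesic_ray_def isometric_map_on_def iso)
  show "geodesic_ray (\<phi> g \<circ> c)"
    using c ray by simp
  have rel: "(\<phi> g \<circ> c, \<phi> g \<circ> d) \<in> asymptotic_rel \<longleftrightarrow> (c, d) \<in> asymptotic_rel" for d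
    unfolding asymptotic_rel_def by (simp add: ray asymptotic_def iso)
  show "boundary_action \<phi> g (asymptotic_rel `` {c}) = asymptotic_rel `` {\<phi> g \<circ> c}"
  proof
    show "boundary_action \<phi> g (asymptotic_rel `` {c}) \<subseteq> asymptotic_rel `` {\<phi> g \<circ> c}"
      by (auto simp: boundary_action_def rel)
    show "asymptotic_rel `` {\<phi> g \<circ> c} \<subseteq> boundary_action \<phi> g (asymptotic_rel `` {c})"
    proof
      fix e assume e: "e \<in> asymptotic_rel `` {\<phi> g \<circ> c}"
      obtain d where "e = \<phi> g \<circ> d" using lift by blast
      with e rel show "e \<in> boundary_action \<phi> g (asymptotic_rel `` {c})"
        by (auto simp: boundary_action_def)
    qed
  qed
qed

definition property_S ::
  "('g, 'm) monoid_scheme \<Rightarrow> ('g \<Rightarrow> 'a::metric_space \<Rightarrow> 'a) \<Rightarrow> bool" where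
  "property_S G \<phi> \<longleftrightarrow>
     (\<forall>r\<ge>0. \<exists>\<tau>\<ge>0. \<forall>p\<^sub>0 p q. dist p p\<^sub>0 \<le> r \<longrightarrow>
        (\<exists>g\<in>carrier G. \<phi> g p = p\<^sub>0 \<and> dist q (\<phi> g q) \<le> \<tau>))"

end

theory Submission
  imports Defs
begin

text \<open>One may take \<open>\<tau>(r) = r\<close>. In a CAT(0) space the distance between two geodesics is a convex
  function of the parameter; along asymptotic rays it is moreover bounded, and a bounded convex
  function on a half-line cannot increase (\<open>asymptotic_rays_dist_le\<close>). So, given \<open>p \<noteq> q\<close>, extend
  the segment from \<open>p\<close> to \<open>q\<close> to a ray \<open>c\<close>, which geodesic completeness allows
  (\<open>geodesic_ray_through\<close>), and use transitivity of the isotropy group of its endpoint at infinity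
  to find \<open>g\<close> in that group with \<open>g p = p\<^sub>0\<close>. The rays \<open>c\<close> and \<open>g c\<close> are asymptotic, \<open>q\<close> and \<open>g q\<close>
  are their points at the same parameter, and hence \<open>d(q, g q) \<le> d(p, g p) = d(p, p\<^sub>0)\<close>. If
  \<open>p = q\<close>, any \<open>g\<close> with \<open>g p = p\<^sub>0\<close> will do.

  Convexity comes from the comparison inequality in the usual way: in a triangle, the segment that
  joins points at the same proportion of two sides is at most as long as in the Euclidean triangle,
  where it is governed by similarity (\<open>CAT0_similar_triangles\<close>); a quadrilateral is cut by a
  diagonal into two triangles (\<open>CAT0_dist_convex\<close>).\<close>

text \<open>Place the first side on the horizontal axis; the law of cosines then dictates the
  coordinates of the third vertex, and the triangle inequalities make its height a real number.\<close>

lemma comparison_triangle_exists: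
  fixes a b c :: real
  assumes "a \<le> b + c" "b \<le> a + c" "c \<le> a + b"
  shows "\<exists>p q r :: real^2. dist p q = a \<and> dist q r = b \<and> dist r p = c"
proof (cases "a = 0")
  case True
  with assms have "b = c" "c \<ge> 0" by auto
  then have "dist (vector [0, 0] :: real^2) (vector [0, 0]) = a
      \<and> dist (vector [0, 0] :: real^2) (vector [c, 0]) = b
      \<and> dist (vector [c, 0] :: real^2) (vector [0, 0]) = c"
    using True by (simp add: dist_vec_def L2_set_def sum_2 dist_real_def)
  then show ?thesis by blast
next
  case False
  with assms have pos: "a > 0" "b \<ge> 0" "c \<ge> 0" by linarith+
  define u where "u = (a\<^sup>2 + c\<^sup>2 - b\<^sup>2) / (2 * a)"
  define v where "v = sqrt (c\<^sup>2 - u\<^sup>2)"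
  have u: "2 * a * u = a\<^sup>2 + c\<^sup>2 - b\<^sup>2"
    using pos by (simp add: u_def)
  have "b\<^sup>2 \<le> (a + c)\<^sup>2" "(a - c)\<^sup>2 \<le> b\<^sup>2"
    using assms pos by (auto intro!: power_mono simp: abs_le_square_iff[symmetric])
  then have "2 * a * u \<le> 2 * a * c" "2 * a * (- u) \<le> 2 * a * c"
    using u by (auto simp: power2_eq_square algebra_simps)
  then have "\<bar>u\<bar> \<le> c"
    using pos mult_le_cancel_left_pos[of "2 * a" u c] mult_le_cancel_left_pos[of "2 * a" "- u" c]
    by (simp add: abs_le_iff del: mult_minus_right)
  then have v: "v\<^sup>2 = c\<^sup>2 - u\<^sup>2"
    unfolding v_def by (simp add: abs_le_square_iff[symmetric])
  have "(a - u)\<^sup>2 + v\<^sup>2 = b\<^sup>2"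
    using u v by (simp add: power2_eq_square algebra_simps)
  then have "dist (vector [0, 0] :: real^2) (vector [a, 0]) = a
      \<and> dist (vector [a, 0] :: real^2) (vector [u, v]) = b
      \<and> dist (vector [u, v] :: real^2) (vector [0, 0]) = c"
    using pos v by (simp add: dist_vec_def L2_set_def sum_2 dist_real_def)
  then show ?thesis by blast
qed

lemma geodesic_side_image:
  assumes "isometric_map_on {0..a} c" "0 \<le> a"
  shows "geodesic_side (c ` {0..a}) (c 0) (c a)"
proof -
  have "dist (c 0) (c a) = a"
    using assms by (simp add: isometric_map_on_def)
  then show ?thesis
    using assms unfolding geodesic_side_def by (intro exI[of _ c]) simp
qed

lemma isometric_map_on_reverse:
  assumes "isometric_map_on {0..a} c"
  shows "isometric_map_on {0..a} (\<lambda>t. c (a - t))"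
  using assms by (auto simp: isometric_map_on_def dist_real_def)

lemma geodesic_side_reverse:
  assumes "isometric_map_on {0..a} c" "0 \<le> a"
  shows "geodesic_side (c ` {0..a}) (c a) (c 0)"
proof -
  have "(\<lambda>t. c (a - t)) ` {0..a} = c ` ((\<lambda>t. a - t) ` {0..a})"
    by (simp only: image_image)
  also have "(\<lambda>t. a - t) ` {0..a} = {0..a}"
    by simp
  finally show ?thesis
    using geodesic_side_image[OF isometric_map_on_reverse[OF assms(1)] assms(2)] by simp
qed

lemma CAT0_geodesic_exists:
  fixes x y :: "'a::metric_space"
  assumes "CAT0 TYPE('a)"
  obtains c where "isometric_map_on {0..dist x y} c" "c 0 = x" "c (dist x y) = y"
  using assms unfolding CAT0_def geodesic_space_def geodesic_side_def by blast

text \<open>In the comparison triangle the two points cut off a triangle similar to the whole one, whose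
  third side is therefore exactly \<open>s\<close> times the opposite side.\<close>

lemma CAT0_similar_triangles:
  fixes c e :: "real \<Rightarrow> 'a::metric_space"
  assumes CAT0: "CAT0 TYPE('a)"
    and c: "isometric_map_on {0..a} c" and e: "isometric_map_on {0..b} e"
    and start: "c 0 = e 0" and ab: "0 \<le> a" "0 \<le> b" and s: "0 \<le> s" "s \<le> 1"
  shows "dist (c (s * a)) (e (s * b)) \<le> s * dist (c a) (e b)"
proof -
  obtain f where f: "isometric_map_on {0..dist (c a) (e b)} f"
      "f 0 = c a" "f (dist (c a) (e b)) = e b"
    using CAT0_geodesic_exists[OF CAT0] .
  let ?S1 = "c ` {0..a}" and ?S2 = "f ` {0..dist (c a) (e b)}" and ?S3 = "e ` {0..b}"
  have sides: "geodesic_side ?S1 (c 0) (c a)" "geodesic_side ?S2 (c a) (e b)"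
      "geodesic_side ?S3 (e b) (c 0)"
    using geodesic_side_image[OF c] geodesic_side_image[OF f(1)] geodesic_side_reverse[OF e] ab f start
    by auto
  obtain p' q' r' :: "real^2" where tri: "dist p' q' = dist (c 0) (c a)"
      "dist q' r' = dist (c a) (e b)" "dist r' p' = dist (e b) (c 0)"
    using comparison_triangle_exists[of "dist (c 0) (c a)" "dist (c a) (e b)" "dist (e b) (c 0)"]
    by (metis dist_commute dist_triangle add.commute)
  have len: "dist (c 0) (c a) = a" "dist (e b) (c 0) = b"
  proof -
    show "dist (c 0) (c a) = a"
      using c ab by (simp add: isometric_map_on_def)
    show "dist (e b) (c 0) = b"
      unfolding start using e ab by (simp add: isometric_map_on_def)
  qed
  have param: "0 \<le> s * a" "s * a \<le> a" "0 \<le> s * b" "s * b \<le> b"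
    using s ab by (auto simp: mult_left_le_one_le)
  define x' where "x' = p' + s *\<^sub>R (q' - p')"
  define y' where "y' = p' + s *\<^sub>R (r' - p')"
  have "x' \<in> closed_segment p' q'"
    using s unfolding in_segment x'_def by (intro exI[of _ s]) (simp add: algebra_simps)
  moreover have "dist p' x' = dist (c 0) (c (s * a))"
  proof -
    have "dist p' x' = s * dist p' q'"
      using s by (simp add: x'_def dist_norm norm_minus_commute)
    also have "\<dots> = dist (c 0) (c (s * a))"
      using c param ab tri len by (simp add: isometric_map_on_def dist_real_def)
    finally show ?thesis .
  qed
  ultimately have X: "comparison_point ?S1 (c 0) p' q' (c (s * a)) x'"
    using param by (auto simp: comparison_point_def)
  have "y' \<in> closed_segment r' p'"
    using s unfolding in_segment y'_def by (intro exI[of _ "1 - s"]) (simp add: algebra_simps)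
  moreover have "dist r' y' = dist (e b) (e (s * b))"
  proof -
    have "r' - y' = (1 - s) *\<^sub>R (r' - p')"
      by (simp add: y'_def algebra_simps)
    then have "dist r' y' = (1 - s) * dist r' p'"
      using s by (simp add: dist_norm)
    also have "\<dots> = dist (e b) (e (s * b))"
      using e param ab tri len by (simp add: isometric_map_on_def dist_real_def algebra_simps)
    finally show ?thesis .
  qed
  ultimately have Y: "comparison_point ?S3 (e b) r' p' (e (s * b)) y'"
    using param by (auto simp: comparison_point_def)
  have "dist (c (s * a)) (e (s * b)) \<le> dist x' y'"
    using CAT0[unfolded CAT0_def Let_def, THEN conjunct2] sides tri X Y by blast
  also have "x' - y' = s *\<^sub>R (q' - r')"
    by (simp add: x'_def y'_def algebra_simps)
  then have "dist x' y' = s * dist (c a) (e b)"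
    using s tri by (simp add: dist_norm)
  finally show ?thesis .
qed

lemma CAT0_dist_convex:
  fixes c e :: "real \<Rightarrow> 'a::metric_space"
  assumes CAT0: "CAT0 TYPE('a)"
    and c: "isometric_map_on {0..T} c" and e: "isometric_map_on {0..T} e"
    and T: "0 \<le> T" and s: "0 \<le> s" "s \<le> 1"
  shows "dist (c (s * T)) (e (s * T)) \<le> (1 - s) * dist (c 0) (e 0) + s * dist (c T) (e T)"
proof -
  define L where "L = dist (c 0) (e T)"
  \<comment> \<open>the diagonal of the quadrilateral; its point at proportion \<open>s\<close> is the intermediate point\<close>
  obtain f where f: "isometric_map_on {0..L} f" "f 0 = c 0" "f L = e T"
    unfolding L_def using CAT0_geodesic_exists[OF CAT0] .
  have L: "0 \<le> L" by (simp add: L_def)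
  have "dist (c (s * T)) (f (s * L)) \<le> s * dist (c T) (e T)"
    using CAT0_similar_triangles[OF CAT0 c f(1) _ T L s] f by simp
  moreover have "dist (f (s * L)) (e (s * T)) \<le> (1 - s) * dist (c 0) (e 0)"
  proof -
    have eq: "L - (1 - s) * L = s * L" "T - (1 - s) * T = s * T"
      by (auto simp: algebra_simps)
    show ?thesis
      using CAT0_similar_triangles[OF CAT0 isometric_map_on_reverse[OF f(1)]
          isometric_map_on_reverse[OF e] _ L T, of "1 - s"] f s
      by (simp add: eq)
  qed
  ultimately show ?thesis
    using dist_triangle[of "c (s * T)" "e (s * T)" "f (s * L)"] by linarith
qed

text \<open>Compare with a far away parameter \<open>T\<close>: convexity bounds the distance at \<open>t\<close> by the initial
  distance plus \<open>t / T\<close> times the uniform bound, and the latter term vanishes as \<open>T\<close> grows.\<close>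

lemma asymptotic_rays_dist_le:
  fixes c e :: "real \<Rightarrow> 'a::metric_space"
  assumes CAT0: "CAT0 TYPE('a)" and c: "geodesic_ray c" and e: "geodesic_ray e"
    and asym: "asymptotic c e" and t: "0 \<le> t"
  shows "dist (c t) (e t) \<le> dist (c 0) (e 0)"
proof (rule field_le_epsilon)
  fix \<epsilon> :: real
  assume \<epsilon>: "0 < \<epsilon>"
  obtain A where A: "0 \<le> A" "\<And>u. 0 \<le> u \<Longrightarrow> dist (c u) (e u) \<le> A"
    using asym by (auto simp: asymptotic_def)
  define T where "T = t + t * A / \<epsilon> + 1"
  have "0 \<le> t * A / \<epsilon>"
    using t A \<epsilon> by simp
  then have T: "0 < T" "t \<le> T" "t * A / \<epsilon> \<le> T"
    unfolding T_def using t by linarith+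
  define s where "s = t / T"
  have s: "0 \<le> s" "s \<le> 1" "s * T = t"
    using t T by (auto simp: s_def)
  have on: "isometric_map_on {0..T} c" "isometric_map_on {0..T} e"
    using c e by (auto simp: geodesic_ray_def isometric_map_on_def)
  have "dist (c t) (e t) \<le> (1 - s) * dist (c 0) (e 0) + s * dist (c T) (e T)"
    using CAT0_dist_convex[OF CAT0 on _ s(1,2)] T s(3) by simp
  also have "\<dots> \<le> dist (c 0) (e 0) + s * A"
    using s T A(2)[of T] by (intro add_mono mult_left_le_one_le mult_left_mono) auto
  also have "s * A \<le> \<epsilon>"
    using T \<epsilon> by (simp add: s_def field_simps)
  finally show "dist (c t) (e t) \<le> dist (c 0) (e 0) + \<epsilon>"
    by simp
qed

lemma geodesic_ray_through:
  fixes p q :: "'a::metric_space"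
  assumes CAT0: "CAT0 TYPE('a)" and complete: "geodesically_complete TYPE('a)" and "p \<noteq> q"
  obtains c where "geodesic_ray c" "c 0 = p" "c (dist p q) = q"
proof -
  obtain f :: "real \<Rightarrow> 'a" where f: "isometric_map_on {0..dist p q} f" "f 0 = p" "f (dist p q) = q"
    using CAT0_geodesic_exists[OF CAT0] .
  then have "geodesic_segment 0 (dist p q) f"
    using \<open>p \<noteq> q\<close> by (simp add: geodesic_segment_def)
  then obtain l where "geodesic_line l" "\<forall>t\<in>{0..dist p q}. l t = f t"
    using complete unfolding geodesically_complete_def by blast
  then show thesis
    using f by (intro that[of l])
      (auto simp: geodesic_line_def geodesic_ray_def isometric_map_on_def)
qed

lemma stabilizer_class_asymptotic:
  assumes act: "isometric_action G \<phi>" and c: "geodesic_ray c"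
    and g: "g \<in> stabilizer G (boundary_action \<phi>) (asymptotic_rel `` {c})"
  shows "asymptotic c (\<phi> g \<circ> c)"
proof -
  have G: "g \<in> carrier G" and fixed: "boundary_action \<phi> g (asymptotic_rel `` {c}) = asymptotic_rel `` {c}"
    using g by (auto simp: stabilizer_def)
  have "asymptotic_rel `` {c} = asymptotic_rel `` {\<phi> g \<circ> c}"
    using boundary_action_class(2)[OF act G c] fixed by simp
  then have "(c, \<phi> g \<circ> c) \<in> asymptotic_rel"
    using eq_equiv_class[OF _ equiv_asymptotic_rel] boundary_action_class(1)[OF act G c] by blast
  then show ?thesis
    by (simp add: asymptotic_rel_def)
qed

theorem corollary5p3:
  fixes G :: "('g, 'm) monoid_scheme"
    and \<phi> :: "'g \<Rightarrow> 'a::metric_space \<Rightarrow> 'a"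
  assumes "CAT0 TYPE('a)"
    and "geodesically_complete TYPE('a)"
    and "isometric_action G \<phi>"
    and "transitive_action G UNIV \<phi>"
    and "\<And>\<xi>. \<xi> \<in> boundary \<Longrightarrow>
      transitive_action (G\<lparr>carrier := stabilizer G (boundary_action \<phi>) \<xi>\<rparr>) UNIV \<phi>"
  shows "property_S G \<phi>"
proof -
  have "\<exists>g\<in>carrier G. \<phi> g p = p\<^sub>0 \<and> dist q (\<phi> g q) \<le> dist p p\<^sub>0" for p\<^sub>0 p q
  proof (cases "p = q")
    case True
    then show ?thesis
      using transitive_action.unique_orbit[OF assms(4), of p p\<^sub>0] by auto
  next
    case False
    then obtain c where c: "geodesic_ray c" "c 0 = p" "c (dist p q) = q"
      using geodesic_ray_through[OF assms(1,2)] by blast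
    let ?\<xi> = "asymptotic_rel `` {c}"
    have "?\<xi> \<in> boundary"
      using c(1) by (auto simp: boundary_def intro: quotientI)
    from transitive_action.unique_orbit[OF assms(5)[OF this], of p p\<^sub>0]
    obtain g where g: "g \<in> stabilizer G (boundary_action \<phi>) ?\<xi>" "\<phi> g p = p\<^sub>0"
      by auto
    then have G: "g \<in> carrier G"
      by (simp add: stabilizer_def)
    have "dist q (\<phi> g q) \<le> dist p p\<^sub>0"
      using asymptotic_rays_dist_le[OF assms(1) c(1) boundary_action_class(1)[OF assms(3) G c(1)]
          stabilizer_class_asymptotic[OF assms(3) c(1) g(1)], of "dist p q"] c g(2)
      by simp
    with G g(2) show ?thesis by blast
  qed
  then show ?thesis
    unfolding property_S_def by (meson order_trans)
qed

end
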